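(* Suppose that the sequences $\alpha=(\alpha_\lambda)$ and $\beta=(\beta_\lambda)$ form a Bailey pair relative to $b$, i.e. $\beta_\lambda=\sum_\mu M_{\lambda\mu}(b)\,\alpha_\mu$ for all partitions $\lambda$. Then the sequences $\alpha',\beta'$ defined by $$\alpha'_\lambda=S_\lambda(b)\,\alpha_\lambda,\qquad \beta'_\lambda=\sum_\mu N_{\lambda\mu}(b)\,\beta_\mu$$ also form a Bailey pair relative to $b$, i.e. $\beta'_\lambda=\sum_\mu M_{\lambda\mu}(b)\,\alpha'_\mu$ for all partitions $\lambda$.
   Context: Fix $n\ge1$. Partitions are $\lambda=(\lambda_1\ge\cdots\ge\lambda_n\ge0)$ with integer parts, $\lambda_{n+1}=0$; $\mu\subseteq\lambda$ means $\mu_i\le\lambda_i$ for all $i$; $|\lambda|=\sum\lambda_i$, $n(\lambda)=\sum(i-1)\lambda_i$, $n(\lambda')=\sum\binom{\lambda_i}{2}$. Matrices are indexed by partitions and are lower triangular (entry $(\lambda,\mu)$ is $0$ unless $\mu\subseteq\lambda$), so all sums are finite. Parameters $q,t,b,\sigma,\rho$ are generic complex numbers; the entries of the sequences are scalars (functions of the parameters). Notation: for integers $m\ge0$, $(a)_m=\prod_{k=0}^{m-1}(1-aq^k)$, and $(a)_m=1/(aq^m)_{-m}$ for $m<0$; $(a)_\lambda=\prod_{i=1}^n(at^{1-i})_{\lambda_i}$; $(a_1,\dots,a_k)_\lambda=(a_1)_\lambda\cdots(a_k)_\lambda$. Macdonald functions (basic case $p=0$): $\lambda/\mu$ is a horizontal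 strip ($\mu\prec\lambda$) if $\lambda_1\ge\mu_1\ge\lambda_2\ge\cdots\ge\lambda_n\ge\mu_n$. For such $\lambda,\mu$, $$H_{\lambda/\mu}=\prod_{1\le i<j\le n}\left\{\frac{(q^{\mu_i-\mu_{j-1}}t^{j-i})_{\mu_{j-1}-\lambda_j}(q^{\lambda_i+\lambda_j}t^{3-j-i}b)_{\mu_{j-1}-\lambda_j}}{(q^{\mu_i-\mu_{j-1}+1}t^{j-i-1})_{\mu_{j-1}-\lambda_j}(q^{\lambda_i+\lambda_j+1}t^{2-j-i}b)_{\mu_{j-1}-\lambda_j}}\frac{(q^{\lambda_i-\mu_{j-1}+1}t^{j-i-1})_{\mu_{j-1}-\lambda_j}}{(q^{\lambda_i-\mu_{j-1}}t^{j-i})_{\mu_{j-1}-\lambda_j}}\right\}\prod_{1\le i<j-1\le n}\frac{(q^{\mu_i+\lambda_j+1}t^{1-j-i}b)_{\mu_{j-1}-\lambda_j}}{(q^{\mu_i+\lambda_j}t^{2-j-i}b)_{\mu_{j-1}-\lambda_j}},$$ $$W_{\lambda/\mu}(x;q,t,a,b)=H_{\lambda/\mu}\frac{(x^{-1},ax)_\lambda(qbx/t,qb/(axt))_\mu}{(x^{-1},ax)_\mu(qbx,qb/(ax))_\lambda}\prod_{i=1}^n\left\{\frac{1-bt^{1-2i}q^{2\mu_i}}{1-bt^{1-2i}}\frac{(bt^{1-2i})_{\mu_i+\lambda_{i+1}}}{(bqt^{-2i})_{\mu_i+\lambda_{i+1}}}t^{i(\mu_i-\lambda_{i+1})}\right\}$$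 for one variable $x$ (zero if $\lambda/\mu$ is not a horizontal strip), and $$W_{\lambda/\mu}(y,z_1,\dots,z_\ell;q,t,a,b)=\sum_{\nu\prec\lambda}W_{\lambda/\nu}(yt^{-\ell};q,t,at^{2\ell},bt^\ell)W_{\nu/\mu}(z_1,\dots,z_\ell;q,t,a,b).$$ $W_\mu=W_{\mu/0}$; $q^\lambda t^{\delta(n)}=(q^{\lambda_1}t^{n-1},\dots,q^{\lambda_n})$; $$W_\mu(x;q,t,0,bt^{1-n}):=\lim_{a\to0}(b/a)^{|\mu|}W_\mu(x;q,t,at^{2-2n},bt^{1-n}).$$ Matrices: $M_{\lambda\mu}(b)=L_\mu(b)\,W_\mu(q^\lambda t^{\delta(n)};q,t,0,bt^{1-n})$ with $$L_\mu(b)=(-1)^{|\mu|}q^{2|\mu|+n(\mu')}t^{n(\mu)}\frac{(bt^{1-n})_\mu}{(qt^{n-1})_\mu}\prod_{1\le i<j\le n}\frac{(qt^{j-i})_{\mu_i-\mu_j}(bt^{3-i-j})_{\mu_i+\mu_j}}{(qt^{j-i-1})_{\mu_i-\mu_j}(bt^{2-i-j})_{\mu_i+\mu_j}};$$ $S(b)$ is the diagonal matrix with entries $S_\lambda(b)=\dfrac{(\sigma,\rho)_\lambda}{(qb/\sigma,qb/\rho)_\lambda}\left(\dfrac{qb}{\rho\sigma}\right)^{|\lambda|}$; and $N(b):=M(b)\,S(b)\,M^{-1}(b)$. *)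

theory Defs
  imports "HOL-Analysis.Infinite_Sum"
begin

text \<open>A partition with at most \<open>n\<close> parts is a function whose values at \<open>1, \<dots>, n\<close> are the parts
  and which vanishes elsewhere; in particular the value at \<open>n + 1\<close> is \<open>0\<close>, and inclusion of
  partitions is the pointwise order on functions.\<close>

type_synonym part = "nat \<Rightarrow> nat"

definition Par :: "nat \<Rightarrow> part set" where
  "Par n = {lam. (\<forall>i\<in>{1..<n}. lam (i + 1) \<le> lam i) \<and> (\<forall>i. i \<notin> {1..n} \<longrightarrow> lam i = 0)}"

definition psize :: "nat \<Rightarrow> part \<Rightarrow> nat" where
  "psize n lam = (\<Sum>i=1..n. lam i)"

definition pn :: "nat \<Rightarrow> part \<Rightarrow> nat" where
  "pn n lam = (\<Sum>i=1..n. (i - 1) * lam i)"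

text \<open>The statistic \<open>n(lam')\<close> of the conjugate partition.\<close>

definition pn_conj :: "nat \<Rightarrow> part \<Rightarrow> nat" where
  "pn_conj n lam = (\<Sum>i=1..n. lam i choose 2)"

text \<open>\<open>hstrip n \<mu> lam\<close> says that \<open>lam/\<mu>\<close> is a horizontal strip (\<open>\<mu> \<prec> lam\<close>).\<close>

definition hstrip :: "nat \<Rightarrow> part \<Rightarrow> part \<Rightarrow> bool" where
  "hstrip n \<mu> lam \<longleftrightarrow> (\<forall>i\<in>{1..n}. \<mu> i \<le> lam i) \<and> (\<forall>i\<in>{1..<n}. lam (i + 1) \<le> \<mu> i)"

definition qpoch :: "complex \<Rightarrow> complex \<Rightarrow> int \<Rightarrow> complex" where
  "qpoch q a m =
     (if 0 \<le> m then (\<Prod>k<nat m. 1 - a * q ^ k)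
      else 1 / (\<Prod>k<nat (- m). 1 - a * q powi m * q ^ k))"

definition ppoch :: "nat \<Rightarrow> complex \<Rightarrow> complex \<Rightarrow> complex \<Rightarrow> part \<Rightarrow> complex" where
  "ppoch n q t a lam = (\<Prod>i=1..n. qpoch q (a * t powi (1 - int i)) (int (lam i)))"

definition H_fun :: "nat \<Rightarrow> complex \<Rightarrow> complex \<Rightarrow> complex \<Rightarrow> part \<Rightarrow> part \<Rightarrow> complex" where
  "H_fun n q t b lam \<mu> =
     (\<Prod>(i, j)\<in>{(i, j). 1 \<le> i \<and> i < j \<and> j \<le> n}.
        let m = int (\<mu> (j - 1)) - int (lam j) in
        (qpoch q (q powi (int (\<mu> i) - int (\<mu> (j - 1))) * t powi (int j - int i)) m
          * qpoch q (q powi (int (lam i) + int (lam j)) * t powi (3 - int j - int i) * b) m)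
        / (qpoch q (q powi (int (\<mu> i) - int (\<mu> (j - 1)) + 1) * t powi (int j - int i - 1)) m
          * qpoch q (q powi (int (lam i) + int (lam j) + 1) * t powi (2 - int j - int i) * b) m)
        * (qpoch q (q powi (int (lam i) - int (\<mu> (j - 1)) + 1) * t powi (int j - int i - 1)) m
          / qpoch q (q powi (int (lam i) - int (\<mu> (j - 1))) * t powi (int j - int i)) m))
   * (\<Prod>(i, j)\<in>{(i, j). 1 \<le> i \<and> i < j - 1 \<and> j - 1 \<le> n}.
        let m = int (\<mu> (j - 1)) - int (lam j) in
        qpoch q (q powi (int (\<mu> i) + int (lam j) + 1) * t powi (1 - int j - int i) * b) m
        / qpoch q (q powi (int (\<mu> i) + int (lam j)) * t powi (2 - int j - int i) * b) m)"

text \<open>One variable. At \<open>x = q ^ N\<close> the quotient of the factors \<open>(1/x)\<^bsub>lam\<^esub> / (1/x)\<^sub>\<mu>\<close> can be \<open>0 / 0\<close>,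
  namely if \<open>\<mu> 1 > N\<close>. This is harmless below: at the points \<open>q\<^bsup>lam\<^esup> t\<^bsup>\<delta>(n)\<^esup>\<close> the variables are
  inserted with decreasing exponents \<open>N\<close>, so that any term of the branching formula
  containing such a quotient also contains a vanishing factor with nonzero denominator, coming
  from a later variable.\<close>

definition W1 :: "nat \<Rightarrow> complex \<Rightarrow> complex \<Rightarrow> complex \<Rightarrow> complex \<Rightarrow> part \<Rightarrow> part \<Rightarrow> complex \<Rightarrow> complex" where
  "W1 n q t a b lam \<mu> x =
     (if hstrip n \<mu> lam then
        H_fun n q t b lam \<mu>
        * (ppoch n q t (1 / x) lam * ppoch n q t (a * x) lam
            * (ppoch n q t (q * b * x / t) \<mu> * ppoch n q t (q * b / (a * x * t)) \<mu>))
        / (ppoch n q t (1 / x) \<mu> * ppoch n q t (a * x) \<mu>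
            * (ppoch n q t (q * b * x) lam * ppoch n q t (q * b / (a * x)) lam))
        * (\<Prod>i=1..n.
             (1 - b * t powi (1 - 2 * int i) * q ^ (2 * \<mu> i)) / (1 - b * t powi (1 - 2 * int i))
             * (qpoch q (b * t powi (1 - 2 * int i)) (int (\<mu> i) + int (lam (i + 1)))
                / qpoch q (b * q * t powi (- 2 * int i)) (int (\<mu> i) + int (lam (i + 1))))
             * t powi (int i * (int (\<mu> i) - int (lam (i + 1)))))
      else 0)"

text \<open>Several variables, given as a list. The value for the empty list is a convention
  compatible with the branching formula.\<close>

fun W :: "nat \<Rightarrow> complex \<Rightarrow> complex \<Rightarrow> complex \<Rightarrow> complex \<Rightarrow> part \<Rightarrow> part \<Rightarrow> complex list \<Rightarrow> complex" where
  "W n q t a b lam \<mu> [] = (if lam = \<mu> then 1 else 0)"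
| "W n q t a b lam \<mu> [x] = W1 n q t a b lam \<mu> x"
| "W n q t a b lam \<mu> (y # z # zs) =
     (\<Sum>\<nu> | \<nu> \<in> Par n \<and> hstrip n \<nu> lam.
        W1 n q t (a * t ^ (2 * length (z # zs))) (b * t ^ length (z # zs)) lam \<nu>
           (y * t powi (- int (length (z # zs))))
        * W n q t a b \<nu> \<mu> (z # zs))"

text \<open>\<open>W_lim n q t b \<mu> xs\<close> is \<open>W\<^sub>\<mu>(xs; q, t, 0, b t\<^bsup>1-n\<^esup>)\<close>.\<close>

definition W_lim :: "nat \<Rightarrow> complex \<Rightarrow> complex \<Rightarrow> complex \<Rightarrow> part \<Rightarrow> complex list \<Rightarrow> complex" where
  "W_lim n q t b \<mu> xs =
     Lim (at 0) (\<lambda>a. (b / a) ^ psize n \<mu>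
        * W n q t (a * t powi (2 - 2 * int n)) (b * t powi (1 - int n)) \<mu> (\<lambda>_. 0) xs)"

definition spec_point :: "nat \<Rightarrow> complex \<Rightarrow> complex \<Rightarrow> part \<Rightarrow> complex list" where
  "spec_point n q t lam = map (\<lambda>i. q ^ lam i * t ^ (n - i)) [1..<n + 1]"

type_synonym pmat = "part \<Rightarrow> part \<Rightarrow> complex"

text \<open>The sums over all partitions below have only finitely many nonzero terms, because the
  matrices involved are lower triangular.\<close>

definition pmat_mult :: "nat \<Rightarrow> pmat \<Rightarrow> pmat \<Rightarrow> pmat" where
  "pmat_mult n A B = (\<lambda>lam \<mu>. \<Sum>\<^sub>\<infinity>\<nu>\<in>Par n. A lam \<nu> * B \<nu> \<mu>)"

definition pmat_app :: "nat \<Rightarrow> pmat \<Rightarrow> (part \<Rightarrow> complex) \<Rightarrow> part \<Rightarrow> complex" where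
  "pmat_app n A \<alpha> = (\<lambda>lam. \<Sum>\<^sub>\<infinity>\<mu>\<in>Par n. A lam \<mu> * \<alpha> \<mu>)"

definition pmat_diag :: "(part \<Rightarrow> complex) \<Rightarrow> pmat" where
  "pmat_diag d = (\<lambda>lam \<mu>. if lam = \<mu> then d lam else 0)"

definition lower_triangular :: "nat \<Rightarrow> pmat \<Rightarrow> bool" where
  "lower_triangular n A \<longleftrightarrow> (\<forall>lam\<in>Par n. \<forall>\<mu>\<in>Par n. \<not> \<mu> \<le> lam \<longrightarrow> A lam \<mu> = 0)"

text \<open>The two-sided inverse in the algebra of lower triangular matrices. Entries whose indices
  are not both in \<open>Par n\<close> carry no meaning; they are set to \<open>0\<close> to make the inverse unique.\<close>

definition pmat_inv :: "nat \<Rightarrow> pmat \<Rightarrow> pmat" where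
  "pmat_inv n A =
     (THE B. lower_triangular n B
        \<and> (\<forall>lam \<mu>. \<not> (lam \<in> Par n \<and> \<mu> \<in> Par n) \<longrightarrow> B lam \<mu> = 0)
        \<and> (\<forall>lam\<in>Par n. \<forall>\<mu>\<in>Par n.
             pmat_mult n A B lam \<mu> = pmat_diag (\<lambda>_. 1) lam \<mu>
             \<and> pmat_mult n B A lam \<mu> = pmat_diag (\<lambda>_. 1) lam \<mu>))"

definition L_coeff :: "nat \<Rightarrow> complex \<Rightarrow> complex \<Rightarrow> complex \<Rightarrow> part \<Rightarrow> complex" where
  "L_coeff n q t b \<mu> =
     (- 1) ^ psize n \<mu> * q ^ (2 * psize n \<mu> + pn_conj n \<mu>) * t ^ pn n \<mu>
     * (ppoch n q t (b * t powi (1 - int n)) \<mu> / ppoch n q t (q * t ^ (n - 1)) \<mu>)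
     * (\<Prod>(i, j)\<in>{(i, j). 1 \<le> i \<and> i < j \<and> j \<le> n}.
          (qpoch q (q * t powi (int j - int i)) (int (\<mu> i) - int (\<mu> j))
            * qpoch q (b * t powi (3 - int i - int j)) (int (\<mu> i) + int (\<mu> j)))
          / (qpoch q (q * t powi (int j - int i - 1)) (int (\<mu> i) - int (\<mu> j))
            * qpoch q (b * t powi (2 - int i - int j)) (int (\<mu> i) + int (\<mu> j))))"

definition M_mat :: "nat \<Rightarrow> complex \<Rightarrow> complex \<Rightarrow> complex \<Rightarrow> pmat" where
  "M_mat n q t b = (\<lambda>lam \<mu>. L_coeff n q t b \<mu> * W_lim n q t b \<mu> (spec_point n q t lam))"

definition S_entry :: "nat \<Rightarrow> complex \<Rightarrow> complex \<Rightarrow> complex \<Rightarrow> complex \<Rightarrow> complex \<Rightarrow> part \<Rightarrow> complex" where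
  "S_entry n q t \<sigma> \<rho> b lam =
     (ppoch n q t \<sigma> lam * ppoch n q t \<rho> lam)
     / (ppoch n q t (q * b / \<sigma>) lam * ppoch n q t (q * b / \<rho>) lam)
     * (q * b / (\<rho> * \<sigma>)) ^ psize n lam"

definition N_mat :: "nat \<Rightarrow> complex \<Rightarrow> complex \<Rightarrow> complex \<Rightarrow> complex \<Rightarrow> complex \<Rightarrow> pmat" where
  "N_mat n q t \<sigma> \<rho> b =
     pmat_mult n (pmat_mult n (M_mat n q t b) (pmat_diag (S_entry n q t \<sigma> \<rho> b)))
       (pmat_inv n (M_mat n q t b))"

definition bailey_pair ::
    "nat \<Rightarrow> complex \<Rightarrow> complex \<Rightarrow> complex \<Rightarrow> (part \<Rightarrow> complex) \<Rightarrow> (part \<Rightarrow> complex) \<Rightarrow> bool" where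
  "bailey_pair n q t b \<alpha> \<beta> \<longleftrightarrow> (\<forall>lam\<in>Par n. \<beta> lam = pmat_app n (M_mat n q t b) \<alpha> lam)"

text \<open>Genericity of the parameters: they avoid the (countably many) hypersurfaces on which a
  denominator in the definitions above, or a diagonal entry of \<open>M_mat\<close>, could vanish.\<close>

definition generic_params :: "complex \<Rightarrow> complex \<Rightarrow> complex \<Rightarrow> complex \<Rightarrow> complex \<Rightarrow> bool" where
  "generic_params q t b \<sigma> \<rho> \<longleftrightarrow>
     q \<noteq> 0 \<and> t \<noteq> 0 \<and> b \<noteq> 0 \<and> \<sigma> \<noteq> 0 \<and> \<rho> \<noteq> 0
     \<and> (\<forall>i j. (i, j) \<noteq> (0, 0) \<longrightarrow> q powi i * t powi j \<noteq> 1)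
     \<and> (\<forall>i j. b * q powi i * t powi j \<noteq> 1)
     \<and> (\<forall>i j. b / \<sigma> * q powi i * t powi j \<noteq> 1)
     \<and> (\<forall>i j. b / \<rho> * q powi i * t powi j \<noteq> 1)"

end

theory Submission
  imports Defs
begin

text \<open>In the algebra of lower triangular matrices \<open>N \<beta> = (M S M\<^sup>-\<^sup>1) (M \<alpha>) = M (S \<alpha>)\<close>, so
  everything rests on \<open>M\<close> being lower triangular with nonzero diagonal. At the point
  \<open>q\<^bsup>lam\<^esup> t\<^bsup>\<delta>(n)\<^esup>\<close> the variable inserted at the \<open>k\<close>-th branching step is \<open>q\<close> to the power \<open>lam k\<close>,
  and the factor \<open>(1/x)\<close> indexed by the current partition vanishes unless its first part is at
  most \<open>lam k\<close>. Together with the interlacing conditions this forces \<open>\<mu> \<le> lam\<close>, and for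
  \<open>\<mu> = lam\<close> it leaves exactly one chain of horizontal strips, which removes the first part at
  every step. Along that chain \<open>H = 1\<close> and each remaining factor has a nonzero limit after
  rescaling by the appropriate power of \<open>a\<close>.\<close>

section \<open>Lower triangular matrices\<close>

lemma finite_Par_le: "finite {\<nu> \<in> Par n. \<nu> \<le> lam}"
proof (rule finite_subset)
  show "{\<nu> \<in> Par n. \<nu> \<le> lam}
    \<subseteq> {f. \<forall>i. (i \<in> {1..n} \<longrightarrow> f i \<in> {..Max (lam ` {1..n})}) \<and> (i \<notin> {1..n} \<longrightarrow> f i = 0)}"
    by (auto simp: Par_def le_fun_def Max_ge_iff)
  show "finite {f. \<forall>i. (i \<in> {1..n} \<longrightarrow> f i \<in> {..Max (lam ` {1..n})}) \<and> (i \<notin> {1..n} \<longrightarrow> f i = (0::nat))}"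
    by (rule finite_set_of_finite_funs) auto
qed

lemma lower_triangularD:
  assumes "lower_triangular n A" "lam \<in> Par n" "\<mu> \<in> Par n" "A lam \<mu> \<noteq> 0"
  shows "\<mu> \<le> lam"
  using assms by (auto simp: lower_triangular_def)

lemma pmat_app_eq_sum:
  assumes "lower_triangular n A" "lam \<in> Par n"
  shows "pmat_app n A f lam = (\<Sum>\<nu> | \<nu> \<in> Par n \<and> \<nu> \<le> lam. A lam \<nu> * f \<nu>)"
proof -
  have "pmat_app n A f lam = (\<Sum>\<^sub>\<infinity>\<nu>\<in>{\<nu> \<in> Par n. \<nu> \<le> lam}. A lam \<nu> * f \<nu>)"
    unfolding pmat_app_def
    by (rule infsum_cong_neutral) (use assms in \<open>auto simp: lower_triangular_def\<close>)
  then show ?thesis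
    by (simp add: finite_Par_le)
qed

text \<open>A column of a product is a matrix applied to a column, so facts about
  \<open>pmat_app\<close> serve both operations.\<close>

lemma pmat_mult_eq_app: "pmat_mult n A B lam \<mu> = pmat_app n A (\<lambda>\<nu>. B \<nu> \<mu>) lam"
  by (simp add: pmat_mult_def pmat_app_def)

lemma pmat_app_cong:
  assumes "\<And>\<nu>. \<nu> \<in> Par n \<Longrightarrow> A lam \<nu> = A' lam \<nu>" "\<And>\<nu>. \<nu> \<in> Par n \<Longrightarrow> f \<nu> = g \<nu>"
  shows "pmat_app n A f lam = pmat_app n A' g lam"
  unfolding pmat_app_def by (rule infsum_cong) (simp add: assms)

lemma lower_triangular_mult:
  assumes "lower_triangular n A" "lower_triangular n B"
  shows "lower_triangular n (pmat_mult n A B)"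
  unfolding lower_triangular_def
proof (intro ballI impI)
  fix lam \<mu> assume *: "lam \<in> Par n" "\<mu> \<in> Par n" "\<not> \<mu> \<le> lam"
  have "B \<nu> \<mu> = 0" if "\<nu> \<in> Par n" "\<nu> \<le> lam" for \<nu>
    using * that order.trans[of \<mu> \<nu> lam] lower_triangularD[OF assms(2), of \<nu> \<mu>] by blast
  with * show "pmat_mult n A B lam \<mu> = 0"
    by (auto simp: pmat_mult_eq_app pmat_app_eq_sum[OF assms(1)] intro!: sum.neutral)
qed

text \<open>Every contributing index lies below \<open>lam\<close>, so all sums run over one finite
  set and can be interchanged.\<close>

lemma pmat_app_assoc:
  assumes A: "lower_triangular n A" and B: "lower_triangular n B" and lam: "lam \<in> Par n"
  shows "pmat_app n (pmat_mult n A B) f lam = pmat_app n A (pmat_app n B f) lam"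
proof -
  let ?D = "{\<nu> \<in> Par n. \<nu> \<le> lam}"
  \<comment> \<open>The row sum is enlarged from the partitions below \<kappa> to the common set
    \<open>?D\<close>; the added entries of \<open>B\<close> vanish.\<close>
  have inner: "pmat_app n B f \<kappa> = (\<Sum>\<nu>\<in>?D. B \<kappa> \<nu> * f \<nu>)" if "\<kappa> \<in> ?D" for \<kappa>
  proof -
    have \<kappa>: "\<kappa> \<in> Par n" "\<kappa> \<le> lam" using that by auto
    have "B \<kappa> \<nu> * f \<nu> = 0" if "\<nu> \<in> ?D - {\<nu> \<in> Par n. \<nu> \<le> \<kappa>}" for \<nu>
      using that lower_triangularD[OF B \<kappa>(1), of \<nu>] by auto
    then show ?thesis
      unfolding pmat_app_eq_sum[OF B \<kappa>(1)]
      by (intro sum.mono_neutral_left finite_Par_le Collect_mono conjI impI ballI)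
         (use \<kappa>(2) in \<open>auto intro: order.trans[of _ \<kappa> lam]\<close>)
  qed
  have "pmat_app n (pmat_mult n A B) f lam
      = (\<Sum>\<nu>\<in>?D. (\<Sum>\<kappa>\<in>?D. A lam \<kappa> * B \<kappa> \<nu>) * f \<nu>)"
    using lam by (simp add: pmat_app_eq_sum[OF lower_triangular_mult[OF A B]] pmat_mult_eq_app
        pmat_app_eq_sum[OF A])
  also have "\<dots> = (\<Sum>\<kappa>\<in>?D. A lam \<kappa> * (\<Sum>\<nu>\<in>?D. B \<kappa> \<nu> * f \<nu>))"
    unfolding sum_distrib_left sum_distrib_right mult.assoc by (rule sum.swap)
  also have "\<dots> = pmat_app n A (pmat_app n B f) lam"
    unfolding pmat_app_eq_sum[OF A lam] by (intro sum.cong) (simp_all add: inner)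
  finally show ?thesis .
qed

lemma lower_triangular_diag: "lower_triangular n (pmat_diag d)"
  by (auto simp: lower_triangular_def pmat_diag_def)

lemma pmat_app_diag:
  assumes "lam \<in> Par n"
  shows "pmat_app n (pmat_diag d) f lam = d lam * f lam"
proof -
  have "pmat_app n (pmat_diag d) f lam
      = (\<Sum>\<nu> | \<nu> \<in> Par n \<and> \<nu> \<le> lam. if lam = \<nu> then d lam * f lam else 0)"
    unfolding pmat_app_eq_sum[OF lower_triangular_diag assms]
    by (intro sum.cong) (auto simp: pmat_diag_def)
  also have "\<dots> = d lam * f lam"
    using finite_Par_le assms by (subst sum.delta') auto
  finally show ?thesis .
qed

section \<open>Inverses by forward substitution\<close>

lemma psize_strict_mono:
  assumes "\<nu> < lam" "\<nu> \<in> Par n" "lam \<in> Par n"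
  shows "psize n \<nu> < psize n lam"
proof -
  obtain i where i: "\<nu> i < lam i" using assms(1) by (auto simp: less_fun_def le_fun_def not_le)
  then have "i \<in> {1..n}" using assms(3) by (force simp: Par_def)
  with i assms(1) show ?thesis unfolding psize_def
    by (intro sum_strict_mono_ex1) (auto simp: less_fun_def le_fun_def)
qed

text \<open>Forward substitution: the equation \<open>A B = 1\<close>, read along row
  \<open>lam\<close>, is solved for the entry of \<open>B\<close> that meets the diagonal of
  \<open>A\<close>. The condition \<open>lam \<in> Par n\<close> in the index set makes
  \<open>psize\<close> decrease, which gives termination.\<close>

function right_inv :: "nat \<Rightarrow> pmat \<Rightarrow> pmat" where
  "right_inv n A lam \<mu> = ((if lam = \<mu> then 1 else 0)
     - (\<Sum>\<nu> | \<nu> \<in> Par n \<and> lam \<in> Par n \<and> \<nu> < lam. A lam \<nu> * right_inv n A \<nu> \<mu>)) / A lam lam"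
  by auto
termination
  by (relation "measure (\<lambda>(n, A, lam, \<mu>). psize n lam)") (auto intro: psize_strict_mono)

declare right_inv.simps [simp del]

lemma right_inv_nonzero_imp_le: "right_inv n A lam \<mu> \<noteq> 0 \<Longrightarrow> \<mu> \<le> lam"
proof (induction n A lam \<mu> rule: right_inv.induct)
  case (1 n A lam \<mu>)
  show ?case
  proof (rule ccontr)
    assume not_le: "\<not> \<mu> \<le> lam"
    have "right_inv n A \<nu> \<mu> = 0" if "\<nu> \<in> Par n" "lam \<in> Par n" "\<nu> < lam" for \<nu>
      using 1(1)[of \<nu>] that not_le order.trans[of \<mu> \<nu> lam] by (auto dest: less_imp_le)
    with not_le have "right_inv n A lam \<mu> = 0"
      by (subst right_inv.simps) (auto intro!: sum.neutral)
    with 1(2) show False by simp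
  qed
qed

lemma lower_triangular_right_inv: "lower_triangular n (right_inv n A)"
  unfolding lower_triangular_def using right_inv_nonzero_imp_le by blast

lemma Par_le_eq_insert:
  "lam \<in> Par n \<Longrightarrow> {\<nu> \<in> Par n. \<nu> \<le> lam} = insert lam {\<nu> \<in> Par n. lam \<in> Par n \<and> \<nu> < lam}"
  by auto

lemma mult_right_inv:
  assumes "lower_triangular n A" "lam \<in> Par n" "A lam lam \<noteq> 0"
  shows "pmat_mult n A (right_inv n A) lam \<mu> = pmat_diag (\<lambda>_. 1) lam \<mu>"
proof -
  have fin: "finite {\<nu> \<in> Par n. lam \<in> Par n \<and> \<nu> < lam}"
    by (rule finite_subset[OF _ finite_Par_le[of n lam]]) auto
  have "pmat_mult n A (right_inv n A) lam \<mu> = A lam lam * right_inv n A lam \<mu>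
      + (\<Sum>\<nu> | \<nu> \<in> Par n \<and> lam \<in> Par n \<and> \<nu> < lam. A lam \<nu> * right_inv n A \<nu> \<mu>)"
    using fin by (simp add: pmat_mult_eq_app pmat_app_eq_sum[OF assms(1,2)]
        Par_le_eq_insert[OF assms(2)])
  also have "\<dots> = pmat_diag (\<lambda>_. 1) lam \<mu>"
    using assms(3) by (subst right_inv.simps) (simp add: pmat_diag_def)
  finally show ?thesis .
qed

text \<open>Ensures a nonzero diagonal wherever \<open>A\<close> has one, so that the construction
  can be applied to \<open>right_inv n A\<close> itself.\<close>

lemma right_inv_diag:
  assumes "lam \<in> Par n"
  shows "right_inv n A lam lam = 1 / A lam lam"
proof -
  have "right_inv n A \<nu> lam = 0" if "\<nu> < lam" for \<nu>
    using that right_inv_nonzero_imp_le[of n A \<nu> lam] by (auto simp: less_le_not_le)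
  then show ?thesis
    by (subst right_inv.simps) (auto intro!: sum.neutral)
qed

text \<open>The usual argument \<open>C = (B A) C = B (A C) = B\<close>, carried out for a single
  row and column.\<close>

lemma left_inverse_eq_right_inverse:
  assumes A: "lower_triangular n A" and B: "lower_triangular n B" and lam: "lam \<in> Par n"
    and mu: "\<mu> \<in> Par n"
    and BA: "\<And>\<nu>. \<nu> \<in> Par n \<Longrightarrow> pmat_mult n B A lam \<nu> = pmat_diag (\<lambda>_. 1) lam \<nu>"
    and AC: "\<And>\<nu>. \<nu> \<in> Par n \<Longrightarrow> pmat_mult n A C \<nu> \<mu> = pmat_diag (\<lambda>_. 1) \<nu> \<mu>"
  shows "B lam \<mu> = C lam \<mu>"
proof -
  have "C lam \<mu> = pmat_app n (pmat_diag (\<lambda>_. 1)) (\<lambda>\<nu>. C \<nu> \<mu>) lam"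
    by (simp add: pmat_app_diag lam)
  also have "\<dots> = pmat_app n (pmat_mult n B A) (\<lambda>\<nu>. C \<nu> \<mu>) lam"
    by (intro pmat_app_cong) (simp_all add: BA)
  also have "\<dots> = pmat_app n B (\<lambda>\<nu>. pmat_diag (\<lambda>_. 1) \<nu> \<mu>) lam"
    unfolding pmat_app_assoc[OF B A lam]
    by (intro pmat_app_cong) (simp_all flip: AC add: pmat_mult_eq_app)
  also have "\<dots> = (\<Sum>\<nu> | \<nu> \<in> Par n \<and> \<nu> \<le> lam. if \<nu> = \<mu> then B lam \<mu> else 0)"
    unfolding pmat_app_eq_sum[OF B lam] by (intro sum.cong) (auto simp: pmat_diag_def)
  also have "\<dots> = B lam \<mu>"
    using finite_Par_le mu lower_triangularD[OF B lam mu] by (subst sum.delta) auto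
  finally show ?thesis ..
qed

text \<open>The right inverse \<open>?B\<close> of \<open>A\<close> has a right inverse
  \<open>?C\<close> of its own. Since \<open>A\<close> is a left inverse of \<open>?B\<close>, it
  agrees with \<open>?C\<close>, and \<open>?B A = ?B ?C = 1\<close> follows.\<close>

lemma right_inv_mult:
  assumes A: "lower_triangular n A" and diag: "\<And>lam. lam \<in> Par n \<Longrightarrow> A lam lam \<noteq> 0"
    and lam: "lam \<in> Par n" and mu: "\<mu> \<in> Par n"
  shows "pmat_mult n (right_inv n A) A lam \<mu> = pmat_diag (\<lambda>_. 1) lam \<mu>"
proof -
  let ?B = "right_inv n A" and ?C = "right_inv n (right_inv n A)"
  have BC: "pmat_mult n ?B ?C \<kappa> \<nu> = pmat_diag (\<lambda>_. 1) \<kappa> \<nu>" if "\<kappa> \<in> Par n" for \<kappa> \<nu>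
    using that diag by (intro mult_right_inv lower_triangular_right_inv) (simp_all add: right_inv_diag)
  have "A \<kappa> \<mu> = ?C \<kappa> \<mu>" if "\<kappa> \<in> Par n" for \<kappa>
    by (rule left_inverse_eq_right_inverse[where A = ?B and C = ?C, OF lower_triangular_right_inv A that mu])
       (simp_all add: mult_right_inv[OF A that, OF diag[OF that]] BC)
  then have "pmat_mult n ?B A lam \<mu> = pmat_mult n ?B ?C lam \<mu>"
    unfolding pmat_mult_eq_app by (intro pmat_app_cong) simp_all
  with BC[OF lam] show ?thesis by simp
qed

text \<open>\<open>pmat_inv\<close> is a definite description, so its properties become available
  through existence and uniqueness.\<close>

lemma pmat_inv_works:
  assumes A: "lower_triangular n A" and diag: "\<And>lam. lam \<in> Par n \<Longrightarrow> A lam lam \<noteq> 0"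
  shows "lower_triangular n (pmat_inv n A)"
    and "\<And>lam \<mu>. lam \<in> Par n \<Longrightarrow> \<mu> \<in> Par n \<Longrightarrow>
      pmat_mult n (pmat_inv n A) A lam \<mu> = pmat_diag (\<lambda>_. 1) lam \<mu>"
proof -
  let ?is_inv = "\<lambda>B. lower_triangular n B
        \<and> (\<forall>lam \<mu>. \<not> (lam \<in> Par n \<and> \<mu> \<in> Par n) \<longrightarrow> B lam \<mu> = 0)
        \<and> (\<forall>lam\<in>Par n. \<forall>\<mu>\<in>Par n.
             pmat_mult n A B lam \<mu> = pmat_diag (\<lambda>_. 1) lam \<mu>
             \<and> pmat_mult n B A lam \<mu> = pmat_diag (\<lambda>_. 1) lam \<mu>)"
  \<comment> \<open>\<open>right_inv\<close> may be nonzero at indices outside \<open>Par n\<close>,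
    where the description demands 0; hence the truncation.\<close>
  define R where "R lam \<mu> = (if lam \<in> Par n \<and> \<mu> \<in> Par n then right_inv n A lam \<mu> else 0)" for lam \<mu>
  have "?is_inv R"
  proof (intro conjI allI ballI impI)
    show "lower_triangular n R"
      using lower_triangular_right_inv[of n A] by (simp add: lower_triangular_def R_def)
    fix lam \<mu> assume *: "lam \<in> Par n" "\<mu> \<in> Par n"
    have "pmat_mult n A R lam \<mu> = pmat_mult n A (right_inv n A) lam \<mu>"
      unfolding pmat_mult_eq_app using * by (intro pmat_app_cong) (simp_all add: R_def)
    then show "pmat_mult n A R lam \<mu> = pmat_diag (\<lambda>_. 1) lam \<mu>"
      using mult_right_inv[OF A *(1), OF diag[OF *(1)]] by simp
    have "pmat_mult n R A lam \<mu> = pmat_mult n (right_inv n A) A lam \<mu>"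
      unfolding pmat_mult_eq_app using * by (intro pmat_app_cong) (simp_all add: R_def)
    then show "pmat_mult n R A lam \<mu> = pmat_diag (\<lambda>_. 1) lam \<mu>"
      using right_inv_mult[OF A, OF diag *] by simp
  qed (auto simp: R_def)
  moreover have "B = C" if "?is_inv B" "?is_inv C" for B C
  proof (intro ext)
    fix lam \<mu>
    show "B lam \<mu> = C lam \<mu>"
    proof (cases "lam \<in> Par n \<and> \<mu> \<in> Par n")
      case True
      then have "lam \<in> Par n" "\<mu> \<in> Par n" by auto
      with that show ?thesis
        by (intro left_inverse_eq_right_inverse[where B = B and C = C, OF A]) simp_all
    qed (use that in auto)
  qed
  ultimately have "\<exists>!B. ?is_inv B" by blast
  then have "?is_inv (pmat_inv n A)" unfolding pmat_inv_def by (rule theI')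
  then show "lower_triangular n (pmat_inv n A)"
    and "\<And>lam \<mu>. lam \<in> Par n \<Longrightarrow> \<mu> \<in> Par n \<Longrightarrow>
      pmat_mult n (pmat_inv n A) A lam \<mu> = pmat_diag (\<lambda>_. 1) lam \<mu>"
    by blast+
qed

text \<open>The inverse turns \<beta> back into \<alpha> on \<open>Par n\<close>, so
  \<open>A D A^-1\<close> acts on \<beta> as \<open>A D\<close> acts on \<alpha>.\<close>

lemma conjugated_diag_app:
  assumes A: "lower_triangular n A" and diag: "\<And>lam. lam \<in> Par n \<Longrightarrow> A lam lam \<noteq> 0"
    and \<beta>: "\<And>lam. lam \<in> Par n \<Longrightarrow> \<beta> lam = pmat_app n A \<alpha> lam" and lam: "lam \<in> Par n"
  shows "pmat_app n (pmat_mult n (pmat_mult n A (pmat_diag d)) (pmat_inv n A)) \<beta> lam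
    = pmat_app n A (\<lambda>\<mu>. d \<mu> * \<alpha> \<mu>) lam"
proof -
  have inv: "lower_triangular n (pmat_inv n A)"
    "\<And>lam \<mu>. lam \<in> Par n \<Longrightarrow> \<mu> \<in> Par n \<Longrightarrow>
      pmat_mult n (pmat_inv n A) A lam \<mu> = pmat_diag (\<lambda>_. 1) lam \<mu>"
    using pmat_inv_works[OF A] diag by blast+
  have AD: "lower_triangular n (pmat_mult n A (pmat_diag d))"
    by (intro lower_triangular_mult A lower_triangular_diag)
  have undo: "pmat_app n (pmat_inv n A) \<beta> \<mu> = \<alpha> \<mu>" if "\<mu> \<in> Par n" for \<mu>
  proof -
    have "pmat_app n (pmat_inv n A) \<beta> \<mu> = pmat_app n (pmat_mult n (pmat_inv n A) A) \<alpha> \<mu>"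
      unfolding pmat_app_assoc[OF inv(1) A that] by (intro pmat_app_cong) (simp_all add: \<beta>)
    also have "\<dots> = pmat_app n (pmat_diag (\<lambda>_. 1)) \<alpha> \<mu>"
      using that by (intro pmat_app_cong) (simp_all add: inv(2))
    finally show ?thesis using that by (simp add: pmat_app_diag)
  qed
  have "pmat_app n (pmat_mult n (pmat_mult n A (pmat_diag d)) (pmat_inv n A)) \<beta> lam
      = pmat_app n (pmat_mult n A (pmat_diag d)) \<alpha> lam"
    unfolding pmat_app_assoc[OF AD inv(1) lam] by (intro pmat_app_cong) (simp_all add: undo)
  also have "\<dots> = pmat_app n A (\<lambda>\<mu>. d \<mu> * \<alpha> \<mu>) lam"
    unfolding pmat_app_assoc[OF A lower_triangular_diag lam]
    by (intro pmat_app_cong) (simp_all add: pmat_app_diag)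
  finally show ?thesis .
qed

section \<open>Generic parameters and Pochhammer symbols\<close>

definition generic_qt :: "complex \<Rightarrow> complex \<Rightarrow> bool" where
  "generic_qt q t \<longleftrightarrow> q \<noteq> 0 \<and> t \<noteq> 0 \<and> (\<forall>i j. (i, j) \<noteq> (0, 0) \<longrightarrow> q powi i * t powi j \<noteq> 1)"

text \<open>For nonzero \<open>q\<close> and \<open>t\<close> this says that \<open>z\<close> lies
  outside the multiplicative group they generate; one condition on \<open>b\<close> then covers all
  its shifts.\<close>

definition off_lattice :: "complex \<Rightarrow> complex \<Rightarrow> complex \<Rightarrow> bool" where
  "off_lattice q t z \<longleftrightarrow> (\<forall>i j. z * q powi i * t powi j \<noteq> 1)"

lemma generic_qtD: "generic_qt q t \<Longrightarrow> i \<noteq> 0 \<or> j \<noteq> 0 \<Longrightarrow> q powi i * t powi j \<noteq> 1"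
  by (auto simp: generic_qt_def)

lemma off_lattice_shift:
  assumes "generic_qt q t" "off_lattice q t z" "w = z * q powi i * t powi j"
  shows "off_lattice q t w"
  unfolding off_lattice_def
proof (intro allI)
  fix k l
  have "w * q powi k * t powi l = z * q powi (i + k) * t powi (j + l)"
    using assms(1) by (simp add: assms(3) generic_qt_def power_int_add mult_ac)
  then show "w * q powi k * t powi l \<noteq> 1"
    using assms(2) by (simp add: off_lattice_def)
qed

lemma off_lattice_neq_1: "off_lattice q t z \<Longrightarrow> z \<noteq> 1"
  unfolding off_lattice_def by (metis mult.right_neutral power_int_0_right)

lemma qpoch_nonzero: "0 \<le> m \<Longrightarrow> (\<And>k. k < nat m \<Longrightarrow> a * q ^ k \<noteq> 1) \<Longrightarrow> qpoch q a m \<noteq> 0"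
  unfolding qpoch_def by (auto simp: prod_zero_iff)

lemma qpoch_off_lattice:
  assumes "generic_qt q t" "off_lattice q t z" "0 \<le> m"
  shows "qpoch q z m \<noteq> 0"
proof (rule qpoch_nonzero[OF assms(3)])
  show "z * q ^ k \<noteq> 1" for k
    by (rule off_lattice_neq_1[where t = t], rule off_lattice_shift[OF assms(1,2), of _ "int k" 0]) simp
qed

lemma ppoch_off_lattice:
  assumes "generic_qt q t" "off_lattice q t z"
  shows "ppoch n q t z lam \<noteq> 0"
proof -
  have "qpoch q (z * t powi (1 - int i)) (int (lam i)) \<noteq> 0" for i
    by (intro qpoch_off_lattice[OF assms(1)] off_lattice_shift[OF assms, of _ 0 "1 - int i"]) simp_all
  then show ?thesis by (simp add: ppoch_def prod_zero_iff)
qed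

text \<open>In the first row the exponent \<open>k - c\<close> of \<open>q\<close> is negative, as
  \<open>k < lam 1 \<le> c\<close>; in later rows the exponent of \<open>t\<close> is nonzero.
  Genericity excludes a vanishing factor in both cases.\<close>

lemma ppoch_inverse_q_power_nonzero:
  assumes "generic_qt q t" "lam 1 \<le> c"
  shows "ppoch n q t (1 / q ^ c) lam \<noteq> 0"
proof -
  have "qpoch q (1 / q ^ c * t powi (1 - int i)) (int (lam i)) \<noteq> 0" if "1 \<le> i" for i
  proof (rule qpoch_nonzero)
    fix k assume "k < nat (int (lam i))"
    with that assms(2) have "int k - int c \<noteq> 0 \<or> 1 - int i \<noteq> 0"
      by (cases "i = 1") auto
    moreover have "1 / q ^ c * t powi (1 - int i) * q ^ k = q powi (int k - int c) * t powi (1 - int i)"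
      using assms(1) by (simp add: generic_qt_def power_int_diff)
    ultimately show "1 / q ^ c * t powi (1 - int i) * q ^ k \<noteq> 1"
      using generic_qtD[OF assms(1)] by simp
  qed simp
  then show ?thesis unfolding ppoch_def by (auto simp: prod_zero_iff)
qed

text \<open>If \<open>lam 1 > c\<close>, the first row contains the factor with
  \<open>k = c\<close>, which is 0.\<close>

lemma ppoch_inverse_q_power_imp_le:
  assumes "q \<noteq> 0" "1 \<le> n" "ppoch n q t (1 / q ^ c) lam \<noteq> 0"
  shows "lam 1 \<le> c"
proof (rule ccontr)
  assume "\<not> lam 1 \<le> c"
  then have "qpoch q (1 / q ^ c * t powi (1 - int 1)) (int (lam 1)) = 0"
    using assms(1) by (auto simp: qpoch_def prod_zero_iff intro!: bexI[of _ c])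
  moreover have "qpoch q (1 / q ^ c * t powi (1 - int 1)) (int (lam 1)) \<noteq> 0"
    using assms(2,3) unfolding ppoch_def prod_zero_iff[OF finite_atLeastAtMost] by fastforce
  ultimately show False by contradiction
qed

section \<open>Pochhammer symbols as \<open>a\<close> tends to 0\<close>

lemma ppoch_tendsto_1: "((\<lambda>a. ppoch n q t (a * c) lam) \<longlongrightarrow> 1) (at 0)"
proof -
  have "((\<lambda>a. ppoch n q t (a * c) lam) \<longlongrightarrow> ppoch n q t (0 * c) lam) (at 0)"
    unfolding ppoch_def qpoch_def if_P[OF of_nat_0_le_iff] by (intro tendsto_intros)
  then show ?thesis by (simp add: ppoch_def qpoch_def)
qed

text \<open>Multiplying each of the \<open>psize n lam\<close> factors by \<open>a\<close> clears
  its simple pole and leaves a polynomial in \<open>a\<close> that is nonzero at 0.\<close>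

lemma ppoch_pole:
  assumes "q \<noteq> 0" "t \<noteq> 0" "c \<noteq> 0"
  shows "\<exists>l. l \<noteq> 0 \<and> ((\<lambda>a. a ^ psize n lam * ppoch n q t (c / a) lam) \<longlongrightarrow> l) (at 0)"
proof (intro exI conjI)
  let ?f = "\<lambda>a. \<Prod>i=1..n. \<Prod>k<lam i. a - c * t powi (1 - int i) * q ^ k"
  show "?f 0 \<noteq> 0" using assms by (auto simp: prod_zero_iff)
  have eq: "a ^ psize n lam * ppoch n q t (c / a) lam = ?f a" if "a \<noteq> 0" for a
  proof -
    have "a ^ lam i * qpoch q (c / a * t powi (1 - int i)) (int (lam i))
        = (\<Prod>k<lam i. a - c * t powi (1 - int i) * q ^ k)" for i
    proof -
      have "a ^ lam i * qpoch q (c / a * t powi (1 - int i)) (int (lam i))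
        = (\<Prod>k<lam i. a * (1 - c / a * t powi (1 - int i) * q ^ k))"
        by (simp add: qpoch_def prod.distrib)
      also have "\<dots> = (\<Prod>k<lam i. a - c * t powi (1 - int i) * q ^ k)"
        using that by (intro prod.cong) (simp_all add: field_simps)
      finally show ?thesis .
    qed
    then show ?thesis
      by (simp add: psize_def ppoch_def power_sum flip: prod.distrib)
  qed
  have "(?f \<longlongrightarrow> ?f 0) (at 0)" by (intro tendsto_intros)
  then show "((\<lambda>a. a ^ psize n lam * ppoch n q t (c / a) lam) \<longlongrightarrow> ?f 0) (at 0)"
    by (rule Lim_transform_eventually) (use eq in \<open>auto simp: eventually_at_filter\<close>)
qed

section \<open>Macdonald functions at \<open>q\<^bsup>lam\<^esup> t\<^bsup>\<delta>(n)\<^esup>\<close>\<close>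

definition tail_part :: "part \<Rightarrow> part" where
  "tail_part lam = (\<lambda>i. if i = 0 then 0 else lam (i + 1))"

lemma Par_0: "(\<lambda>_. 0) \<in> Par n"
  by (simp add: Par_def)

lemma Par_antimono:
  assumes "lam \<in> Par n" "1 \<le> i" "i \<le> j"
  shows "lam j \<le> lam i"
  using assms(3)
proof (induction j rule: dec_induct)
  case (step j)
  with assms(1,2) have "lam (Suc j) \<le> lam j"
    by (cases "Suc j \<le> n") (auto simp: Par_def)
  with step show ?case by simp
qed simp_all

text \<open>Index 0 is special in \<open>tail_part\<close> because a plain shift would move the
  first part there, outside the support that \<open>Par\<close> allows.\<close>

lemma tail_part_in_Par: "lam \<in> Par n \<Longrightarrow> tail_part lam \<in> Par n"
  by (auto simp: Par_def tail_part_def)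

lemma hstrip_tail_part: "lam \<in> Par n \<Longrightarrow> hstrip n (tail_part lam) lam"
  using Par_antimono[of lam n] by (auto simp: hstrip_def tail_part_def)

lemma psize_tail_part:
  assumes "lam \<in> Par n" "1 \<le> n"
  shows "psize n lam = lam 1 + psize n (tail_part lam)"
proof -
  have "psize n (tail_part lam) = (\<Sum>i=1..n. lam (Suc i))"
    unfolding psize_def by (intro sum.cong) (auto simp: tail_part_def)
  also have "\<dots> = (\<Sum>i=Suc 1..Suc n. lam i)"
    by (simp only: sum.shift_bounds_cl_Suc_ivl)
  also have "\<dots> = (\<Sum>i=Suc 1..n. lam i)"
    using assms by (simp add: Par_def)
  finally show ?thesis
    using assms(2) by (simp add: psize_def sum.atLeast_Suc_atMost)
qed

text \<open>All Pochhammer symbols in \<open>H_fun\<close> have length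
  \<open>\<mu> (j - 1) - lam j\<close>, which is 0 when \<mu> is the tail of
  \<open>lam\<close>.\<close>

lemma H_fun_tail_part: "H_fun n q t b lam (tail_part lam) = 1"
proof -
  have "qpoch q z (int (tail_part lam (j - 1)) - int (lam j)) = 1" if "1 < j" for j z
    using that by (simp add: tail_part_def qpoch_def)
  then have "H_fun n q t b lam (tail_part lam) = 1 * 1"
    unfolding H_fun_def by (intro arg_cong2[of _ _ _ _ "(*)"] prod.neutral) (auto simp: Let_def)
  then show ?thesis by simp
qed

text \<open>The symbols in \<open>a * u * x\<close> tend to 1, those with \<open>a\<close> in a
  denominator have poles of orders \<open>psize n lam\<close> and
  \<open>psize n (tail_part lam)\<close>, and the rest is constant and nonzero. The two orders
  differ by \<open>lam 1\<close>.\<close>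

lemma W1_tail_part_limit:
  assumes qt: "generic_qt q t" and B: "off_lattice q t B" "B \<noteq> 0" and u: "u \<noteq> 0"
    and lam: "lam \<in> Par n" and n: "1 \<le> n"
  shows "\<exists>l. l \<noteq> 0 \<and>
    ((\<lambda>a. (1 / a) ^ lam 1 * W1 n q t (a * u) B lam (tail_part lam) (q ^ lam 1)) \<longlongrightarrow> l) (at 0)"
proof -
  define x where "x = q ^ lam 1"
  let ?\<nu> = "tail_part lam"
  have q0: "q \<noteq> 0" and t0: "t \<noteq> 0" using qt by (auto simp: generic_qt_def)
  have x0: "x \<noteq> 0" by (simp add: x_def q0)
  define R where "R = (\<Prod>i=1..n.
             (1 - B * t powi (1 - 2 * int i) * q ^ (2 * ?\<nu> i)) / (1 - B * t powi (1 - 2 * int i))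
             * (qpoch q (B * t powi (1 - 2 * int i)) (int (?\<nu> i) + int (lam (i + 1)))
                / qpoch q (B * q * t powi (- 2 * int i)) (int (?\<nu> i) + int (lam (i + 1))))
             * t powi (int i * (int (?\<nu> i) - int (lam (i + 1)))))"
  have R: "R \<noteq> 0"
  proof -
    have "off_lattice q t (B * t powi (1 - 2 * int i) * q ^ (2 * ?\<nu> i))" for i
      by (rule off_lattice_shift[OF qt B(1), of _ "int (2 * ?\<nu> i)" "1 - 2 * int i"])
         (simp only: power_int_of_nat mult_ac)
    moreover have "off_lattice q t (B * t powi (1 - 2 * int i))" for i
      by (rule off_lattice_shift[OF qt B(1), of _ 0 "1 - 2 * int i"]) simp
    moreover have "off_lattice q t (B * q * t powi (- 2 * int i))" for i
      by (rule off_lattice_shift[OF qt B(1), of _ 1 "- 2 * int i"]) simp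
    ultimately show ?thesis
      unfolding R_def using t0 qpoch_off_lattice[OF qt]
      by (auto simp: prod_zero_iff dest: off_lattice_neq_1)
  qed
  define C where "C = ppoch n q t (1 / x) lam * ppoch n q t (q * B * x / t) ?\<nu>
    / (ppoch n q t (1 / x) ?\<nu> * ppoch n q t (q * B * x) lam)"
  have C: "C \<noteq> 0"
  proof -
    \<comment> \<open>The first part of the tail is at most \<open>lam 1\<close> as well, so neither
      symbol in \<open>1 / x\<close> vanishes and no quotient \<open>0 / 0\<close> occurs.\<close>
    have "?\<nu> 1 \<le> lam 1" using Par_antimono[OF lam, of 1 2] by (simp add: tail_part_def numeral_2_eq_2)
    then have "ppoch n q t (1 / x) lam \<noteq> 0" "ppoch n q t (1 / x) ?\<nu> \<noteq> 0"
      unfolding x_def by (auto intro!: ppoch_inverse_q_power_nonzero[OF qt])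
    moreover have "ppoch n q t (q * B * x / t) ?\<nu> \<noteq> 0"
      by (intro ppoch_off_lattice[OF qt] off_lattice_shift[OF qt B(1), of _ "1 + int (lam 1)" "-1"])
         (use q0 in \<open>simp add: x_def power_int_add power_int_minus field_simps\<close>)
    moreover have "ppoch n q t (q * B * x) lam \<noteq> 0"
      by (intro ppoch_off_lattice[OF qt] off_lattice_shift[OF qt B(1), of _ "1 + int (lam 1)" 0])
         (use q0 in \<open>simp add: x_def power_int_add\<close>)
    ultimately show ?thesis by (simp add: C_def)
  qed
  \<comment> \<open>Chosen so that the two symbols with poles have arguments \<open>c / a\<close>
    and \<open>c / t / a\<close>.\<close>
  define c where "c = q * B / (u * x)"
  have c0: "c \<noteq> 0" using q0 B u x0 by (simp add: c_def)
  obtain l1 where l1: "l1 \<noteq> 0"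
      "((\<lambda>a. a ^ psize n ?\<nu> * ppoch n q t (c / t / a) ?\<nu>) \<longlongrightarrow> l1) (at 0)"
    using ppoch_pole[of q t "c / t" n ?\<nu>] q0 t0 c0 by auto
  obtain l2 where l2: "l2 \<noteq> 0" "((\<lambda>a. a ^ psize n lam * ppoch n q t (c / a) lam) \<longlongrightarrow> l2) (at 0)"
    using ppoch_pole[of q t c n lam] q0 t0 c0 by auto
  let ?f = "\<lambda>a. C * R * (ppoch n q t (a * (u * x)) lam / ppoch n q t (a * (u * x)) ?\<nu>)
    * ((a ^ psize n ?\<nu> * ppoch n q t (c / t / a) ?\<nu>) / (a ^ psize n lam * ppoch n q t (c / a) lam))"
  have "(?f \<longlongrightarrow> C * R * (1 / 1) * (l1 / l2)) (at 0)"
    using l1 l2 by (intro tendsto_intros ppoch_tendsto_1) auto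
  moreover have "?f a = (1 / a) ^ lam 1 * W1 n q t (a * u) B lam ?\<nu> x" if "a \<noteq> 0" for a
  proof -
    have e: "a * u * x = a * (u * x)" "q * B / (a * (u * x) * t) = c / t / a"
        "q * B / (a * (u * x)) = c / a"
      by (simp_all add: c_def field_simps)
    have W1: "W1 n q t (a * u) B lam ?\<nu> x
      = ppoch n q t (1 / x) lam * ppoch n q t (a * (u * x)) lam
          * (ppoch n q t (q * B * x / t) ?\<nu> * ppoch n q t (c / t / a) ?\<nu>)
        / (ppoch n q t (1 / x) ?\<nu> * ppoch n q t (a * (u * x)) ?\<nu>
          * (ppoch n q t (q * B * x) lam * ppoch n q t (c / a) lam)) * R"
      by (simp only: W1_def R_def H_fun_tail_part hstrip_tail_part[OF lam] if_True e mult_1_left)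
    have p: "a ^ psize n ?\<nu> / a ^ psize n lam = (1 / a) ^ lam 1"
      using that by (simp add: psize_tail_part[OF lam n] power_add power_one_over)
    have "?f a = a ^ psize n ?\<nu> / a ^ psize n lam * (C * R
        * (ppoch n q t (a * (u * x)) lam / ppoch n q t (a * (u * x)) ?\<nu>)
        * (ppoch n q t (c / t / a) ?\<nu> / ppoch n q t (c / a) lam))"
      by (simp add: mult_ac)
    also have "\<dots> = (1 / a) ^ lam 1 * W1 n q t (a * u) B lam ?\<nu> x"
      unfolding W1 p by (simp add: C_def mult_ac)
    finally show ?thesis .
  qed
  ultimately have "((\<lambda>a. (1 / a) ^ lam 1 * W1 n q t (a * u) B lam ?\<nu> x) \<longlongrightarrow> C * R * (1 / 1) * (l1 / l2)) (at 0)"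
    by (elim Lim_transform_eventually) (auto simp: eventually_at_filter)
  moreover have "C * R * (1 / 1) * (l1 / l2) \<noteq> 0" using C R l1 l2 by simp
  ultimately show ?thesis unfolding x_def by blast
qed

section \<open>The branching formula along a list of variables\<close>

lemma W_Cons:
  assumes "\<mu> \<in> Par n"
  shows "W n q t a b lam \<mu> (y # zs) = (\<Sum>\<nu> | \<nu> \<in> Par n \<and> hstrip n \<nu> lam.
        W1 n q t (a * t ^ (2 * length zs)) (b * t ^ length zs) lam \<nu> (y * t powi (- int (length zs)))
        * W n q t a b \<nu> \<mu> zs)"
\<comment> \<open>A single variable has its own clause in \<open>W\<close>. There the empty list
  gives a Kronecker delta that collapses the sum at \<nu> = \<mu>; if \<mu> is not a horizontal
  strip in \<open>lam\<close>, both sides are 0.\<close>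
proof (cases zs)
  case Nil
  have fin: "finite {\<nu> \<in> Par n. hstrip n \<nu> lam}"
    by (rule finite_subset[OF _ finite_Par_le[of n "\<lambda>i. if i \<in> {1..n} then lam i else 0"]])
       (auto simp: hstrip_def Par_def le_fun_def)
  have "(\<Sum>\<nu> | \<nu> \<in> Par n \<and> hstrip n \<nu> lam. W1 n q t a b lam \<nu> y * (if \<nu> = \<mu> then 1 else 0))
      = (\<Sum>\<nu> | \<nu> \<in> Par n \<and> hstrip n \<nu> lam. if \<nu> = \<mu> then W1 n q t a b lam \<mu> y else 0)"
    by (intro sum.cong) auto
  also have "\<dots> = W1 n q t a b lam \<mu> y"
    using fin assms by (subst sum.delta) (auto simp: W1_def)
  finally show ?thesis by (simp add: Nil)
qed simp

text \<open>Lists instead of partitions, so that one branching step of \<open>W\<close> removes the head and keeps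
  the remaining variables in the same form.\<close>

definition list_part :: "nat list \<Rightarrow> part" where
  "list_part cs = (\<lambda>i. if 1 \<le> i \<and> i \<le> length cs then cs ! (i - 1) else 0)"

primrec spec_vars :: "complex \<Rightarrow> complex \<Rightarrow> nat list \<Rightarrow> complex list" where
  "spec_vars q t [] = []"
| "spec_vars q t (c # cs) = q ^ c * t ^ length cs # spec_vars q t cs"

lemma length_spec_vars [simp]: "length (spec_vars q t cs) = length cs"
  by (induction cs) auto

lemma nth_spec_vars: "i < length cs \<Longrightarrow> spec_vars q t cs ! i = q ^ (cs ! i) * t ^ (length cs - Suc i)"
  by (induction cs arbitrary: i) (auto simp: nth_Cons')

lemma spec_point_eq_spec_vars: "spec_point n q t lam = spec_vars q t (map lam [1..<n + 1])"
  by (rule nth_equalityI) (simp_all add: spec_point_def nth_spec_vars del: upt_Suc)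

lemma list_part_map: "lam \<in> Par n \<Longrightarrow> list_part (map lam [1..<n + 1]) = lam"
  by (auto simp: list_part_def Par_def fun_eq_iff simp del: upt_Suc)

lemma list_part_Cons_1: "list_part (c # cs) 1 = c"
  by (simp add: list_part_def)

lemma tail_part_list_part_Cons: "tail_part (list_part (c # cs)) = list_part cs"
  by (auto simp: list_part_def tail_part_def fun_eq_iff)

text \<open>The rescaling of the leading variable in the branching formula cancels its power of
  \<open>t\<close>, so each \<open>W1\<close> is evaluated at a pure power of
  \<open>q\<close>.\<close>

lemma spec_var_rescale: "t \<noteq> 0 \<Longrightarrow> q ^ c * t ^ l * t powi (- int l) = (q ^ c :: complex)"
  by (simp add: power_int_minus)

text \<open>A nonzero value has a nonzero branching term \<nu>: its factor \<open>W1\<close> bounds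
  the first part by \<open>c\<close>, interlacing bounds part \<open>i + 1\<close> by
  \<open>\<nu> i\<close>, and induction on the variables bounds \<nu>.\<close>

lemma W_nonzero_imp_le:
  assumes "q \<noteq> 0" "t \<noteq> 0" "1 \<le> n"
  shows "lam \<in> Par n \<Longrightarrow> W n q t a b lam (\<lambda>_. 0) (spec_vars q t cs) \<noteq> 0 \<Longrightarrow> lam \<le> list_part cs"
proof (induction cs arbitrary: lam)
  case Nil
  then show ?case by (auto simp: le_fun_def split: if_splits)
next
  case (Cons c cs)
  from Cons.prems obtain \<nu> where \<nu>: "\<nu> \<in> Par n" "hstrip n \<nu> lam"
    and W1: "W1 n q t (a * t ^ (2 * length cs)) (b * t ^ length cs) lam \<nu> (q ^ c) \<noteq> 0"
    and W: "W n q t a b \<nu> (\<lambda>_. 0) (spec_vars q t cs) \<noteq> 0"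
    using assms(2) by (auto simp: W_Cons[OF Par_0] spec_var_rescale elim!: sum.not_neutral_contains_not_neutral)
  have "\<nu> (Suc i) \<le> list_part (c # cs) (Suc (Suc i))" for i
    using le_funD[OF Cons.IH[OF \<nu>(1) W], of "Suc i"]
    unfolding tail_part_list_part_Cons[of c cs, symmetric] by (simp add: tail_part_def)
  \<comment> \<open>Division by 0 gives 0, so a nonzero \<open>W1\<close> has a nonzero numerator,
    which contains the symbol in \<open>1 / x\<close>.\<close>
  moreover have "lam 1 \<le> c"
    using W1 by (intro ppoch_inverse_q_power_imp_le[where t = t, OF assms(1,3)])
      (auto simp: W1_def split: if_splits)
  moreover have "lam (Suc (Suc i)) \<le> \<nu> (Suc i)" for i
    using \<nu>(2) Cons.prems(1) by (cases "Suc (Suc i) \<le> n") (auto simp: hstrip_def Par_def)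
  ultimately have "lam (Suc i) \<le> list_part (c # cs) (Suc i)" for i
    by (metis One_nat_def le_trans list_part_Cons_1 not0_implies_Suc)
  moreover have "lam 0 = 0" using Cons.prems(1) by (simp add: Par_def)
  ultimately show ?case unfolding le_fun_def by (metis not0_implies_Suc zero_le)
qed

text \<open>Interlacing bounds \<nu> below by the tail, and a nonzero remaining factor bounds it
  above by the tail, so at most one term of the branching sum survives.\<close>

lemma W_list_part_Cons:
  assumes "q \<noteq> 0" "t \<noteq> 0" "1 \<le> n" and lam: "list_part (c # cs) \<in> Par n"
  shows "W n q t a b (list_part (c # cs)) (\<lambda>_. 0) (spec_vars q t (c # cs))
    = W1 n q t (a * t ^ (2 * length cs)) (b * t ^ length cs) (list_part (c # cs)) (list_part cs) (q ^ c)
      * W n q t a b (list_part cs) (\<lambda>_. 0) (spec_vars q t cs)"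
proof -
  let ?lam = "list_part (c # cs)" and ?W = "\<lambda>\<nu>. W n q t a b \<nu> (\<lambda>_. 0) (spec_vars q t cs)"
  let ?W1 = "\<lambda>\<nu>. W1 n q t (a * t ^ (2 * length cs)) (b * t ^ length cs) ?lam \<nu> (q ^ c)"
  have tail: "list_part cs = tail_part ?lam" by (simp add: tail_part_list_part_Cons)
  have uniq: "\<nu> = list_part cs" if "\<nu> \<in> Par n" "hstrip n \<nu> ?lam" "?W \<nu> \<noteq> 0" for \<nu>
  proof (rule antisym)
    show "\<nu> \<le> list_part cs" using W_nonzero_imp_le[OF assms(1-3) that(1,3)] .
    show "list_part cs \<le> \<nu>" unfolding le_fun_def
    proof
      fix i
      \<comment> \<open>Outside \<open>{1..<n}\<close> the tail is 0: at index 0 by definition, and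
        from \<open>n\<close> on because there are at most \<open>n\<close> parts.\<close>
      show "list_part cs i \<le> \<nu> i"
        using that(2) lam by (cases "i \<in> {1..<n}") (auto simp: tail hstrip_def tail_part_def Par_def)
    qed
  qed
  have "W n q t a b ?lam (\<lambda>_. 0) (spec_vars q t (c # cs))
      = (\<Sum>\<nu> | \<nu> \<in> Par n \<and> hstrip n \<nu> ?lam. ?W1 \<nu> * ?W \<nu>)"
    using assms(2) by (simp add: W_Cons[OF Par_0] spec_var_rescale)
  also have "\<dots> = (\<Sum>\<nu>\<in>{list_part cs}. ?W1 \<nu> * ?W \<nu>)"
  proof (rule sum.mono_neutral_right)
    show "finite {\<nu> \<in> Par n. hstrip n \<nu> ?lam}"
      by (rule finite_subset[OF _ finite_Par_le[of n ?lam]])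
         (use lam in \<open>auto simp: hstrip_def Par_def le_fun_def\<close>)
    show "{list_part cs} \<subseteq> {\<nu> \<in> Par n. hstrip n \<nu> ?lam}"
      using tail_part_in_Par[OF lam] hstrip_tail_part[OF lam] by (simp add: tail)
  qed (use uniq in auto)
  finally show ?thesis by simp
qed

text \<open>Each branching step absorbs \<open>(1 / a) ^ c\<close> for the first part
  \<open>c\<close> that it removes, and these exponents add up to \<open>psize\<close>. The factor
  \<open>u\<close> accommodates the shift of \<open>a\<close> in \<open>W_lim\<close>.\<close>

lemma W_list_part_limit:
  assumes qt: "generic_qt q t" and b: "off_lattice q t b" "b \<noteq> 0" and u: "u \<noteq> 0" and n: "1 \<le> n"
  shows "list_part cs \<in> Par n \<Longrightarrow> \<exists>l. l \<noteq> 0 \<and>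
    ((\<lambda>a. (1 / a) ^ psize n (list_part cs)
       * W n q t (a * u) b (list_part cs) (\<lambda>_. 0) (spec_vars q t cs)) \<longlongrightarrow> l) (at 0)"
proof (induction cs)
  case Nil
  have "list_part [] = (\<lambda>_. 0)" by (auto simp: list_part_def)
  then show ?case by (auto simp: psize_def intro!: exI[of _ 1])
next
  case (Cons c cs)
  let ?lam = "list_part (c # cs)"
  have q0: "q \<noteq> 0" and t0: "t \<noteq> 0" using qt by (auto simp: generic_qt_def)
  have "list_part cs \<in> Par n"
    using tail_part_in_Par[OF Cons.prems] by (simp add: tail_part_list_part_Cons)
  then obtain l1 where l1: "l1 \<noteq> 0" "((\<lambda>a. (1 / a) ^ psize n (list_part cs)
       * W n q t (a * u) b (list_part cs) (\<lambda>_. 0) (spec_vars q t cs)) \<longlongrightarrow> l1) (at 0)"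
    using Cons.IH by blast
  have "off_lattice q t (b * t ^ length cs)"
    by (rule off_lattice_shift[OF qt b(1), of _ 0 "int (length cs)"]) simp
  moreover have "b * t ^ length cs \<noteq> 0" "u * t ^ (2 * length cs) \<noteq> 0"
    using b u t0 by simp_all
  ultimately obtain l2 where l2: "l2 \<noteq> 0" "((\<lambda>a. (1 / a) ^ c
       * W1 n q t (a * (u * t ^ (2 * length cs))) (b * t ^ length cs) ?lam (list_part cs) (q ^ c)) \<longlongrightarrow> l2) (at 0)"
    using W1_tail_part_limit[OF qt _ _ _ Cons.prems n, of "b * t ^ length cs" "u * t ^ (2 * length cs)"]
    unfolding tail_part_list_part_Cons list_part_Cons_1 by blast
  have "(1 / a) ^ psize n ?lam * W n q t (a * u) b ?lam (\<lambda>_. 0) (spec_vars q t (c # cs))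
    = ((1 / a) ^ c
       * W1 n q t (a * (u * t ^ (2 * length cs))) (b * t ^ length cs) ?lam (list_part cs) (q ^ c))
      * ((1 / a) ^ psize n (list_part cs)
       * W n q t (a * u) b (list_part cs) (\<lambda>_. 0) (spec_vars q t cs))" for a
    unfolding W_list_part_Cons[OF q0 t0 n Cons.prems] psize_tail_part[OF Cons.prems n]
      tail_part_list_part_Cons list_part_Cons_1 power_add
    by (simp only: mult_ac)
  with tendsto_mult[OF l2(2) l1(2)] l1(1) l2(1) show ?case
    by (auto intro!: exI[of _ "l2 * l1"])
qed

section \<open>The Bailey lemma\<close>

lemma M_mat_lower_triangular:
  assumes "q \<noteq> 0" "t \<noteq> 0" "1 \<le> n"
  shows "lower_triangular n (M_mat n q t b)"
  unfolding lower_triangular_def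
proof (intro ballI impI)
  fix lam \<mu> assume lam: "lam \<in> Par n" and mu: "\<mu> \<in> Par n" and "\<not> \<mu> \<le> lam"
  \<comment> \<open>The value vanishes for every \<open>a\<close>, so \<open>W_lim\<close> is the
    limit of the zero function.\<close>
  then have "W n q t a b' \<mu> (\<lambda>_. 0) (spec_point n q t lam) = 0" for a b'
    using W_nonzero_imp_le[OF assms mu, of a b' "map lam [1..<n + 1]"]
    by (auto simp only: spec_point_eq_spec_vars list_part_map)
  then show "M_mat n q t b lam \<mu> = 0"
    unfolding M_mat_def W_lim_def by (simp add: tendsto_Lim)
qed

lemma L_coeff_nonzero:
  assumes qt: "generic_qt q t" and b: "off_lattice q t b" and mu: "\<mu> \<in> Par n"
  shows "L_coeff n q t b \<mu> \<noteq> 0"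
proof -
  have q0: "q \<noteq> 0" and t0: "t \<noteq> 0" using qt by (auto simp: generic_qt_def)
  have b': "off_lattice q t (b * t powi s)" for s
    by (rule off_lattice_shift[OF qt b, of _ 0 s]) simp
  \<comment> \<open>The factors are \<open>1 - q^(k+1) t^s\<close>; the positive exponent of
    \<open>q\<close> lets genericity apply for every \<open>s\<close>.\<close>
  have pos: "qpoch q (q * t powi s) m \<noteq> 0" if "0 \<le> m" for s m
  proof (rule qpoch_nonzero[OF that])
    fix k
    have eq: "q * t powi s * q ^ k = q powi int (Suc k) * t powi s"
      by (simp only: power_int_of_nat power_Suc mult_ac)
    show "q * t powi s * q ^ k \<noteq> 1"
      unfolding eq by (rule generic_qtD[OF qt]) simp
  qed
  have "ppoch n q t (q * t ^ (n - 1)) \<mu> \<noteq> 0"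
  proof -
    have eq: "q * t ^ (n - 1) * t powi (1 - int i) = q * t powi (int (n - 1) + (1 - int i))" for i
      using t0 by (simp only: power_int_add power_int_of_nat mult.assoc simp_thms)
    have "qpoch q (q * t ^ (n - 1) * t powi (1 - int i)) (int (\<mu> i)) \<noteq> 0" for i
      unfolding eq by (rule pos) simp
    then show ?thesis unfolding ppoch_def prod_zero_iff[OF finite_atLeastAtMost] by blast
  qed
  moreover have "ppoch n q t (b * t powi (1 - int n)) \<mu> \<noteq> 0"
    by (intro ppoch_off_lattice[OF qt] b')
  moreover have "0 \<le> int (\<mu> i) - int (\<mu> j)" if "1 \<le> i" "i < j" for i j
    using Par_antimono[OF mu, of i j] that by simp
  moreover have fin: "finite {(i, j). 1 \<le> i \<and> i < j \<and> j \<le> n}"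
    by (rule finite_subset[of _ "{1..n} \<times> {1..n}"]) auto
  ultimately show ?thesis
    unfolding L_coeff_def using q0 t0
    by (auto simp: prod_zero_iff[OF fin] pos qpoch_off_lattice[OF qt b'])
qed

lemma M_mat_diag_nonzero:
  assumes qt: "generic_qt q t" and b: "off_lattice q t b" "b \<noteq> 0" and n: "1 \<le> n" and lam: "lam \<in> Par n"
  shows "M_mat n q t b lam lam \<noteq> 0"
proof -
  have t0: "t \<noteq> 0" using qt by (auto simp: generic_qt_def)
  have "off_lattice q t (b * t powi (1 - int n))"
    by (rule off_lattice_shift[OF qt b(1), of _ 0 "1 - int n"]) simp
  then obtain l where l: "l \<noteq> 0" "((\<lambda>a. (1 / a) ^ psize n lam
       * W n q t (a * t powi (2 - 2 * int n)) (b * t powi (1 - int n)) lam (\<lambda>_. 0)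
           (spec_point n q t lam)) \<longlongrightarrow> l) (at 0)"
    using W_list_part_limit[OF qt _ _ _ n, of "b * t powi (1 - int n)" "t powi (2 - 2 * int n)"
        "map lam [1..<n + 1]"] lam b t0
    by (auto simp only: list_part_map spec_point_eq_spec_vars mult_eq_0_iff power_int_eq_0_iff)
  \<comment> \<open>Normalising by \<open>b / a\<close> instead of \<open>1 / a\<close> contributes
    the nonzero factor \<open>b ^ psize n lam\<close>.\<close>
  have "((\<lambda>a. (b / a) ^ psize n lam
       * W n q t (a * t powi (2 - 2 * int n)) (b * t powi (1 - int n)) lam (\<lambda>_. 0)
           (spec_point n q t lam)) \<longlongrightarrow> b ^ psize n lam * l) (at 0)"
    using tendsto_mult_left[OF l(2), of "b ^ psize n lam"] by (simp add: power_divide)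
  then have "W_lim n q t b lam (spec_point n q t lam) = b ^ psize n lam * l"
    unfolding W_lim_def by (intro tendsto_Lim) simp_all
  then show ?thesis
    unfolding M_mat_def using L_coeff_nonzero[OF qt b(1) lam] l(1) b(2) by simp
qed

theorem theorem3p17:
  fixes n :: nat and q t b \<sigma> \<rho> :: complex and \<alpha> \<beta> :: "part \<Rightarrow> complex"
  assumes "n \<ge> 1"
    and "generic_params q t b \<sigma> \<rho>"
    and "bailey_pair n q t b \<alpha> \<beta>"
  shows "bailey_pair n q t b
           (\<lambda>lam. S_entry n q t \<sigma> \<rho> b lam * \<alpha> lam)
           (pmat_app n (N_mat n q t \<sigma> \<rho> b) \<beta>)"
proof -
  have qt: "generic_qt q t" and b: "off_lattice q t b" "b \<noteq> 0" and 0: "q \<noteq> 0" "t \<noteq> 0"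
    using assms(2) by (auto simp: generic_params_def generic_qt_def off_lattice_def)
  show ?thesis
    using assms(3) unfolding bailey_pair_def N_mat_def
    by (intro ballI conjugated_diag_app M_mat_lower_triangular[OF 0 assms(1)]
        M_mat_diag_nonzero[OF qt b assms(1)]) auto
qed

end
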